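(* Let $f(t,\eta)=\psi(t,\eta)e^{\mathrm{j}\theta(t,\eta)}$ be a random signal in $L^2(\mathbb{R}\times\Omega)$ with $\|f\|_{L^2(\mathbb{R}\times\Omega)}=1$. Suppose that for almost every $\eta\in\Omega$: $f(\cdot,\eta)$, $t f(t,\eta)$ and $\partial_t f(t,\eta)$ (as functions of $t$) belong to $L^2(\mathbb{R})$; $\psi(\cdot,\eta)$ and $\theta(\cdot,\eta)$ are continuously differentiable; and $\lim_{|t|\to\infty} f(t,\eta)=0$. Let $A=\begin{pmatrix} a&b\\ c&d\end{pmatrix}$ with $a,b,c,d\in\mathbb{R}$, $ad-bc=1$, and let $L_A(u,\eta)$ be the linear canonical transform of $f$ with parameter matrix $A$. Then $$\mathbb{E}_\eta[\sigma_t^2(\eta)]\;\mathbb{E}_\eta[\sigma_u^2(\eta)]\;\ge\;\frac{b^2}{4}+\left[\int_\Omega\int_{-\infty}^{+\infty}\left|(t-\mu_t)\left(at+b\,\partial_t\theta(t,\eta)-\mu_u\right)\right|\psi^2(t,\eta)\,dt\,dP\right]^2,$$ where $$\mathbb{E}_\eta[\sigma_t^2(\eta)]=\int_\Omega\int_{-\infty}^{+\infty}(t-\mu_t)^2|f(t,\eta)|^2\,dt\,dP,\qquad \mathbb{E}_\eta[\sigma_u^2(\eta)]=\int_\Omega\int_{-\infty}^{+\infty}(u-\mu_u)^2|L_A(u,\eta)|^2\,du\,dP.$$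
   Context: $(\Omega,\mathcal{F},P)$ is a probability space and $\mathrm{j}$ is the imaginary unit. A random signal is a function $f(t,\eta)=\psi(t,\eta)e^{\mathrm{j}\theta(t,\eta)}$, $t\in\mathbb{R}$, $\eta\in\Omega$, with real-valued amplitude $\psi$ and real-valued phase $\theta$. Its norm is $\|f\|_{L^2(\mathbb{R}\times\Omega)}^2=\int_\Omega\int_{\mathbb{R}}|f(t,\eta)|^2\,dt\,dP$. The linear canonical transform (LCT) of $f$ with parameter matrix $A$ is, for $b\ne0$, $$L_A(u,\eta)=\int_{-\infty}^{+\infty} f(t,\eta)K_A(t,u)\,dt,\qquad K_A(t,u)=\frac{1}{\sqrt{\mathrm{j}2\pi b}}\,e^{\mathrm{j}\left(\frac{a}{2b}t^2-\frac1b tu+\frac{d}{2b}u^2\right)},$$ and for $b=0$, $L_A(u,\eta)=\sqrt d\,e^{\mathrm{j}cdu^2/2}f(du,\eta)$. The means are $\mu_t=\int_\Omega\int_{-\infty}^{+\infty}t|f(t,\eta)|^2\,dt\,dP$ and $\mu_u=\int_\Omega\int_{-\infty}^{+\infty}u|L_A(u,\eta)|^2\,du\,dP$; they are understood to be given by absolutely convergent integrals. *)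

theory Defs
  imports "HOL-Probability.Probability"
begin

definition square_integrable :: "'a measure \<Rightarrow> ('a \<Rightarrow> complex) \<Rightarrow> bool" where
  "square_integrable M g \<longleftrightarrow>
     g \<in> borel_measurable M \<and> integrable M (\<lambda>x. (cmod (g x))\<^sup>2)"

text \<open>A signal is a curried function of the time \<open>t\<close> and the sample point \<open>\<eta>\<close>.\<close>

definition signal_norm :: "'w measure \<Rightarrow> (real \<Rightarrow> 'w \<Rightarrow> complex) \<Rightarrow> real" where
  "signal_norm P f = sqrt (LINT \<eta>|P. LINT t|lborel. (cmod (f t \<eta>))\<^sup>2)"

definition lct_kernel :: "real \<Rightarrow> real \<Rightarrow> real \<Rightarrow> real \<Rightarrow> real \<Rightarrow> complex" where
  "lct_kernel a b d t u =
     1 / csqrt (\<i> * of_real (2 * pi * b)) *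
     exp (\<i> * of_real (a / (2 * b) * t\<^sup>2 - 1 / b * (t * u) + d / (2 * b) * u\<^sup>2))"

text \<open>
  Both square roots are principal complex ones. For \<open>b = 0\<close> the number \<open>d\<close> may be negative, so
  \<open>csqrt\<close> is needed there; the real \<open>sqrt\<close> would be \<open>- sqrt (- d)\<close>.
\<close>

definition lct :: "real \<Rightarrow> real \<Rightarrow> real \<Rightarrow> real \<Rightarrow> (real \<Rightarrow> complex) \<Rightarrow> real \<Rightarrow> complex" where
  "lct a b c d g u =
     (if b \<noteq> 0 then LINT t|lborel. g t * lct_kernel a b d t u
      else csqrt (of_real d) * exp (\<i> * of_real (c * d * u\<^sup>2 / 2)) * g (d * u))"

definition signal_lct ::
  "real \<Rightarrow> real \<Rightarrow> real \<Rightarrow> real \<Rightarrow> (real \<Rightarrow> 'w \<Rightarrow> complex) \<Rightarrow> real \<Rightarrow> 'w \<Rightarrow> complex" where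
  "signal_lct a b c d f u \<eta> = lct a b c d (\<lambda>t. f t \<eta>) u"

text \<open>
  The mean is a Bochner integral, with value \<open>0\<close> when it diverges, so it is only meaningful
  together with \<open>has_signal_mean\<close>.
\<close>

definition has_signal_mean :: "'w measure \<Rightarrow> (real \<Rightarrow> 'w \<Rightarrow> complex) \<Rightarrow> bool" where
  "has_signal_mean P g \<longleftrightarrow>
     integrable (lborel \<Otimes>\<^sub>M P) (\<lambda>(x, \<eta>). x * (cmod (g x \<eta>))\<^sup>2)"

definition signal_mean :: "'w measure \<Rightarrow> (real \<Rightarrow> 'w \<Rightarrow> complex) \<Rightarrow> real" where
  "signal_mean P g = (LINT \<eta>|P. LINT x|lborel. x * (cmod (g x \<eta>))\<^sup>2)"

text \<open>
  No finiteness of the second moments is assumed, so the expected variance is taken in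
  \<open>[0, \<infinity>]\<close>.
\<close>

definition expected_variance :: "'w measure \<Rightarrow> (real \<Rightarrow> 'w \<Rightarrow> complex) \<Rightarrow> ennreal" where
  "expected_variance P g =
     (\<integral>\<^sup>+ \<eta>. \<integral>\<^sup>+ x. ennreal ((x - signal_mean P g)\<^sup>2 * (cmod (g x \<eta>))\<^sup>2) \<partial>lborel \<partial>P)"

end

theory Submission
  imports Defs
begin

text \<open>
  Write \<open>f'\<close> for the time derivative of the signal and put \<open>H = b f' + \<i> (a t - \<mu>\<^sub>u) f\<close>. Up to a
  unit, \<open>H\<close> is the inverse transform of \<open>(u - \<mu>\<^sub>u) L\<^sub>A\<close>, so that Plancherel's theorem
  bounds the second moment of \<open>L\<^sub>A\<close> about \<open>\<mu>\<^sub>u\<close> from below by the energy of \<open>H\<close>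
  (\<open>lct_second_moment_ge\<close>).

  Where \<open>\<psi> \<noteq> 0\<close>, dividing \<open>H\<close> by the phase factor of the signal gives the amplitude part \<open>b \<psi>'\<close> as
  real part and the phase part \<open>(a t + b \<theta>' - \<mu>\<^sub>u) \<psi>\<close> as imaginary part, and the energies of the two
  parts add up. The Cauchy--Schwarz inequality on \<open>\<Omega> \<times> \<real>\<close>, applied to each part against
  \<open>(t - \<mu>\<^sub>t) \<psi>\<close>, yields the two summands of the lower bound (\<open>Cauchy_Schwarz_Re_Im\<close>). The phase part
  gives exactly the squared absolute covariance. The amplitude part gives the square of
  \<open>|b| \<integral>\<integral> |(t - \<mu>\<^sub>t) \<psi> \<psi>'|\<close>, and integration by parts bounds this number from below by \<open>|b| / 2\<close>
  times the energy of the signal, which is \<open>1\<close> (\<open>half_energy_le_weighted_correlation\<close>).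

  Two points are delicate. The second moment of \<open>L\<^sub>A\<close> may be infinite and \<open>f'\<close> need not be integrable,
  so Plancherel's theorem is proved as an inequality in \<open>[0, \<infinity>]\<close>: first for continuous bounded
  integrable functions by Gaussian regularisation (\<open>plancherel_le\<close>), then for derivatives through
  difference quotients and Fatou's lemma (\<open>plancherel_derivative_le\<close>). And amplitude and phase
  are only known separately for each realisation, so the joint measurability that
  Cauchy--Schwarz on the product space requires is obtained from \<open>f\<close> alone: \<open>f'\<close> is a limit of
  difference quotients, and the two parts of \<open>H\<close> are formed with \<open>f / |f|\<close>.
\<close>

section \<open>Integration by parts on the whole line\<close>

text \<open>
  Every interchange of integrals below pairs Lebesgue measure with a probability measure. The
  inner integrals of the norm are then bounded uniformly, which is all that Fubini's theorem asks
  for.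
\<close>

lemma swap_integrals_of_uniform_bound:
  fixes \<Phi> :: "'a \<Rightarrow> 'b \<Rightarrow> 'c::{banach, second_countable_topology}"
  assumes N: "finite_measure N" and M: "sigma_finite_measure M"
    and meas [measurable]: "(\<lambda>(v, t). \<Phi> v t) \<in> borel_measurable (N \<Otimes>\<^sub>M M)"
    and int: "\<And>v. v \<in> space N \<Longrightarrow> integrable M (\<Phi> v)"
    and bound: "\<And>v. v \<in> space N \<Longrightarrow> (LINT t|M. norm (\<Phi> v t)) \<le> C"
  shows "(LINT v|N. LINT t|M. \<Phi> v t) = (LINT t|M. LINT v|N. \<Phi> v t)"
proof -
  interpret N: finite_measure N by fact
  interpret M: sigma_finite_measure M by fact
  interpret pair_sigma_finite N M ..
  have "integrable (N \<Otimes>\<^sub>M M) (\<lambda>(v, t). \<Phi> v t)"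
  proof (rule Fubini_integrable)
    show "integrable N (\<lambda>v. LINT t|M. norm (case (v, t) of (v, t) \<Rightarrow> \<Phi> v t))"
    proof (rule N.integrable_const_bound[where B = C])
      show "AE v in N. norm (LINT t|M. norm (case (v, t) of (v, t) \<Rightarrow> \<Phi> v t)) \<le> C"
        using bound by (auto simp: integral_nonneg_AE)
    qed measurable
    show "AE v in N. integrable M (\<lambda>t. case (v, t) of (v, t) \<Rightarrow> \<Phi> v t)"
      using int by auto
  qed fact
  from Fubini_integral[OF this] show ?thesis
    by simp
qed

text \<open>
  Averaging avoids any discussion of boundary values at infinity: translation invariance gives
  \<open>\<integral> F (t + 1) - F t = 0\<close>, while the integrand is the mean of \<open>F'\<close> over \<open>[t, t + 1]\<close>, so that by
  Fubini the same integral is \<open>\<integral> F'\<close>.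
\<close>

lemma integral_derivative_eq_0:
  fixes F F' :: "real \<Rightarrow> 'a::euclidean_space"
  assumes deriv: "\<And>t. (F has_vector_derivative F' t) (at t)"
    and cont: "continuous_on UNIV F'"
    and F: "integrable lborel F" and F': "integrable lborel F'"
  shows "(LINT t|lborel. F' t) = 0"
proof -
  \<comment> \<open>The uniform distribution on \<open>[0, 1]\<close>.\<close>
  define N :: "real measure" where "N = density lborel (\<lambda>s. ennreal (indicator {0..1} s))"
  have [measurable_cong]: "sets N = sets borel"
    by (simp add: N_def)
  have "emeasure N (space N) = 1"
    by (simp add: N_def emeasure_density ennreal_indicator)
  then have N: "prob_space N" "finite_measure N"
    by (auto intro: prob_spaceI finite_measureI)
  have [measurable]: "F' \<in> borel_measurable borel"
    using F' by auto
  have FTC: "(LINT s|N. F' (t + s)) = F (t + 1) - F t" for t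
  proof -
    have "(LINT s|N. F' (t + s)) = (LINT s|lborel. indicator {0..1} s *\<^sub>R F' (t + s))"
      unfolding N_def by (rule integral_density) auto
    also have "\<dots> = F (t + 1) - F (t + 0)"
    proof (rule integral_FTC_atLeastAtMost)
      show "continuous_on {0..1} (\<lambda>s. F' (t + s))"
        by (intro continuous_on_compose2[OF cont] continuous_intros) auto
      fix s :: real
      have "((\<lambda>s. F (t + s)) has_vector_derivative 1 *\<^sub>R F' (t + s)) (at s)"
        using vector_diff_chain_at[of "\<lambda>s. t + s" 1 s F "F' (t + s)"] deriv[of "t + s"]
          has_vector_derivative_add[OF has_vector_derivative_const has_vector_derivative_id, of t "at s"]
        by (simp add: o_def)
      then show "((\<lambda>s. F (t + s)) has_vector_derivative F' (t + s)) (at s within {0..1})"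
        by (auto intro: has_vector_derivative_at_within)
    qed simp
    finally show ?thesis by simp
  qed
  have shift: "integrable lborel (\<lambda>t. G (t + s))" "(LINT t|lborel. G (t + s)) = (LINT t|lborel. G t)"
    if "integrable lborel G" for G :: "real \<Rightarrow> 'b::euclidean_space" and s
    using lborel_integrable_real_affine[OF that, of 1 s] lborel_integral_real_affine[of 1 G s]
    by (simp_all add: add.commute)
  have "0 = (LINT t|lborel. F (t + 1) - F t)"
    using shift[OF F, of 1] F by simp
  also have "\<dots> = (LINT t|lborel. LINT s|N. F' (t + s))"
    by (simp add: FTC)
  also have "\<dots> = (LINT s|N. LINT t|lborel. F' (t + s))"
  proof (rule swap_integrals_of_uniform_bound[symmetric, OF N(2)])
    show "(\<lambda>(s, t). F' (t + s)) \<in> borel_measurable (N \<Otimes>\<^sub>M lborel)"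
      by measurable
    show "(LINT t|lborel. norm (F' (t + s))) \<le> (LINT t|lborel. norm (F' t))" for s
      using shift(2)[of "\<lambda>t. norm (F' t)" s] F' by simp
  qed (use shift(1)[OF F'] in \<open>auto intro: sigma_finite_lborel\<close>)
  also have "\<dots> = (LINT s|N. (LINT t|lborel. F' t))"
    using shift(2)[OF F'] by simp
  also have "\<dots> = (LINT t|lborel. F' t)"
    using prob_space.prob_space[OF N(1)] by simp
  finally show ?thesis by simp
qed

lemma borel_measurable_cnj [measurable (raw)]:
  "g \<in> borel_measurable M \<Longrightarrow> (\<lambda>x. cnj (g x)) \<in> borel_measurable M"
  by (rule measurable_compose[OF _ borel_measurable_continuous_onI]) (auto intro!: continuous_intros)

lemma integrable_mult_square_integrable:
  assumes "square_integrable M g" "square_integrable M h"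
  shows "integrable M (\<lambda>x. g x * h x)"
proof (rule Bochner_Integration.integrable_bound)
  show "integrable M (\<lambda>x. (cmod (g x))\<^sup>2 + (cmod (h x))\<^sup>2)"
    using assms by (auto simp: square_integrable_def)
  have "cmod (g x * h x) \<le> (cmod (g x))\<^sup>2 + (cmod (h x))\<^sup>2" for x
    using sum_squares_bound[of "cmod (g x)" "cmod (h x)"] mult_nonneg_nonneg[of "cmod (g x)" "cmod (h x)"] by (simp add: norm_mult del: mult_nonneg_nonneg)
  then show "AE x in M. cmod (g x * h x) \<le> norm ((cmod (g x))\<^sup>2 + (cmod (h x))\<^sup>2)"
    by auto
  show "(\<lambda>x. g x * h x) \<in> borel_measurable M"
    using assms by (auto simp: square_integrable_def)
qed

text \<open>
  This makes the Fourier integral of the signal absolutely convergent. Split \<open>|g|\<close> as the product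
  of \<open>(1 + t\<^sup>2)\<^sup>-\<^sup>1\<^sup>/\<^sup>2\<close> and \<open>(1 + t\<^sup>2)\<^sup>1\<^sup>/\<^sup>2 |g|\<close>; both factors are square integrable.
\<close>

lemma integrable_of_square_integrable_moment:
  assumes g: "square_integrable lborel g"
    and tg: "square_integrable lborel (\<lambda>t. of_real t * g t)"
  shows "integrable lborel g"
proof (rule Bochner_Integration.integrable_bound)
  have "integrable lborel (\<lambda>t::real. inverse (1 + t\<^sup>2))"
    using integrable_inverse_1_plus_square by (simp add: set_integrable_def einterval_def)
  then show "integrable lborel (\<lambda>t. inverse (1 + t\<^sup>2) + ((cmod (g t))\<^sup>2 + (cmod (of_real t * g t))\<^sup>2))"
    using assms by (auto simp: square_integrable_def)
  have "cmod (g t) \<le> inverse (1 + t\<^sup>2) + ((cmod (g t))\<^sup>2 + (cmod (of_real t * g t))\<^sup>2)" for t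
  proof -
    define r where "r = sqrt (1 + t\<^sup>2)"
    have r: "r > 0" "r\<^sup>2 = 1 + t\<^sup>2"
      by (auto simp: r_def intro: add_pos_nonneg)
    have "cmod (g t) = inverse r * (r * cmod (g t))"
      using r by simp
    also have "\<dots> \<le> 2 * (inverse r * (r * cmod (g t)))"
      using r by simp
    also have "\<dots> \<le> (inverse r)\<^sup>2 + (r * cmod (g t))\<^sup>2"
      using sum_squares_bound[of "inverse r" "r * cmod (g t)"] by (simp add: mult.assoc)
    also have "\<dots> = inverse (1 + t\<^sup>2) + ((cmod (g t))\<^sup>2 + (cmod (of_real t * g t))\<^sup>2)"
      using r by (simp add: power_mult_distrib power_inverse norm_mult algebra_simps)
    finally show ?thesis .
  qed
  then show "AE t in lborel. norm (g t) \<le> norm (inverse (1 + t\<^sup>2) + ((cmod (g t))\<^sup>2 + (cmod (of_real t * g t))\<^sup>2))"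
    by (auto intro!: AE_I2 order_trans[OF _ abs_ge_self])
  show "g \<in> borel_measurable lborel"
    using g by (auto simp: square_integrable_def)
qed

text \<open>
  The source of the constant \<open>b\<^sup>2 / 4\<close>: the derivative of \<open>(t - m) |g|\<^sup>2\<close> is
  \<open>|g|\<^sup>2 + 2 (t - m) Re (cnj g * g')\<close> and integrates to \<open>0\<close>, so the correlation of \<open>t - m\<close> with
  \<open>Re (cnj g * g')\<close> is minus half of the energy of \<open>g\<close>.
\<close>

lemma half_energy_le_weighted_correlation:
  fixes g g' :: "real \<Rightarrow> complex" and m :: real
  assumes deriv: "\<And>t. (g has_vector_derivative g' t) (at t)"
    and cont: "continuous_on UNIV g'"
    and g: "square_integrable lborel g"
    and tg: "square_integrable lborel (\<lambda>t. of_real t * g t)"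
    and g': "square_integrable lborel g'"
  shows "ennreal (1 / 2) * (\<integral>\<^sup>+ t. ennreal ((cmod (g t))\<^sup>2) \<partial>lborel)
    \<le> (\<integral>\<^sup>+ t. ennreal (\<bar>t - m\<bar> * \<bar>Re (cnj (g t) * g' t)\<bar>) \<partial>lborel)"
proof -
  define F where "F t = (t - m) * (cmod (g t))\<^sup>2" for t
  define F' where "F' t = (cmod (g t))\<^sup>2 + 2 * ((t - m) * Re (cnj (g t) * g' t))" for t
  have contg: "continuous_on UNIV g"
    using deriv by (meson continuous_at_imp_continuous_on has_vector_derivative_continuous)
  have cnj: "square_integrable lborel (\<lambda>t. cnj (g t))" 
    using g by (auto simp: square_integrable_def)
  have mg: "square_integrable lborel (\<lambda>t. of_real (t - m) * g t)"
    unfolding square_integrable_def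
  proof
    show "integrable lborel (\<lambda>t. (cmod (of_real (t - m) * g t))\<^sup>2)"
    proof (rule Bochner_Integration.integrable_bound)
      show "integrable lborel (\<lambda>t. 2 * (cmod (of_real t * g t))\<^sup>2 + 2 * m\<^sup>2 * (cmod (g t))\<^sup>2)"
        using g tg by (auto simp: square_integrable_def)
      have "(t - m)\<^sup>2 \<le> 2 * t\<^sup>2 + 2 * m\<^sup>2" for t
        using zero_le_power2[of "t + m"] by (simp add: power2_eq_square algebra_simps)
      from mult_right_mono[OF this zero_le_power2]
      have "(t - m)\<^sup>2 * (cmod (g t))\<^sup>2 \<le> 2 * t\<^sup>2 * (cmod (g t))\<^sup>2 + 2 * m\<^sup>2 * (cmod (g t))\<^sup>2" for t
        by (metis distrib_right)
      then show "AE t in lborel. norm ((cmod (of_real (t - m) * g t))\<^sup>2)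
          \<le> norm (2 * (cmod (of_real t * g t))\<^sup>2 + 2 * m\<^sup>2 * (cmod (g t))\<^sup>2)"
        by (auto simp: norm_mult power_mult_distrib mult.assoc simp flip: of_real_diff intro!: order_trans[OF _ abs_ge_self])
    qed (use g in \<open>auto simp: square_integrable_def\<close>)
  qed (use g in \<open>auto simp: square_integrable_def\<close>)
  have corr: "integrable lborel (\<lambda>t. (t - m) * Re (cnj (g t) * g' t))"
  proof -
    have "square_integrable lborel (\<lambda>t. cnj (of_real (t - m) * g t))"
      using mg by (auto simp: square_integrable_def simp del: complex_cnj_mult)
    from integrable_mult_square_integrable[OF this g']
    have "integrable lborel (\<lambda>t. Re (cnj (of_real (t - m) * g t) * g' t))" by (rule integrable_Re)
    then show ?thesis
      by (rule Bochner_Integration.integrable_cong[THEN iffD1, rotated 2]) (auto simp: algebra_simps)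
  qed
  have energy: "integrable lborel (\<lambda>t. (cmod (g t))\<^sup>2)"
    using g by (simp add: square_integrable_def)
  have "(LINT t|lborel. F' t) = 0"
  proof (rule integral_derivative_eq_0[of F])
    show "integrable lborel F'"
      unfolding F'_def by (intro Bochner_Integration.integrable_add energy integrable_mult_right corr)
    have "integrable lborel (\<lambda>t. Re (of_real (t - m) * g t * cnj (g t)))"
      using integrable_mult_square_integrable[OF mg cnj] by (rule integrable_Re)
    moreover have "Re (of_real (t - m) * g t * cnj (g t)) = F t" for t
      by (simp add: F_def cmod_power2, simp add: power2_eq_square algebra_simps)
    ultimately show "integrable lborel F"
      by simp
    show "continuous_on UNIV F'"
      unfolding F'_def by (intro continuous_intros cont contg)
    fix t
    have "((\<lambda>t. Re (g t * cnj (g t))) has_vector_derivative Re (g t * cnj (g' t) + g' t * cnj (g t))) (at t)"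
      by (rule bounded_linear.has_vector_derivative[OF bounded_linear_Re])
        (intro has_vector_derivative_mult deriv bounded_linear.has_vector_derivative[OF bounded_linear_cnj])
    then have "((\<lambda>t. (cmod (g t))\<^sup>2) has_real_derivative 2 * Re (cnj (g t) * g' t)) (at t)"
      by (simp add: has_real_derivative_iff_has_vector_derivative cmod_power2 algebra_simps flip: power2_eq_square)
    moreover have "((\<lambda>t. t - m) has_real_derivative 1) (at t)"
      by (auto intro!: derivative_eq_intros)
    ultimately have "((\<lambda>t. (t - m) * (cmod (g t))\<^sup>2) has_real_derivative
        1 * (cmod (g t))\<^sup>2 + 2 * Re (cnj (g t) * g' t) * (t - m)) (at t)"
      by (intro DERIV_mult)
    then show "(F has_vector_derivative F' t) (at t)"
      by (simp add: F_def[abs_def] F'_def has_real_derivative_iff_has_vector_derivative ac_simps)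
  qed
  then have "(LINT t|lborel. (cmod (g t))\<^sup>2) = - 2 * (LINT t|lborel. (t - m) * Re (cnj (g t) * g' t))"
    unfolding F'_def using energy corr by simp
  also have "\<dots> \<le> 2 * (LINT t|lborel. norm ((t - m) * Re (cnj (g t) * g' t)))"
    using integral_norm_bound[of lborel "\<lambda>t. (t - m) * Re (cnj (g t) * g' t)"] by (auto simp: abs_le_iff)
  finally have "1 / 2 * (LINT t|lborel. (cmod (g t))\<^sup>2) \<le> (LINT t|lborel. norm ((t - m) * Re (cnj (g t) * g' t)))"
    by simp
  then have "ennreal (1 / 2 * (LINT t|lborel. (cmod (g t))\<^sup>2)) \<le> ennreal (LINT t|lborel. norm ((t - m) * Re (cnj (g t) * g' t)))"
    by (rule ennreal_leI)
  also have "\<dots> = (\<integral>\<^sup>+ t. ennreal (norm ((t - m) * Re (cnj (g t) * g' t))) \<partial>lborel)"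
    using corr by (intro nn_integral_eq_integral[symmetric]) auto
  finally have *: "ennreal (1 / 2 * (LINT t|lborel. (cmod (g t))\<^sup>2))
      \<le> (\<integral>\<^sup>+ t. ennreal (norm ((t - m) * Re (cnj (g t) * g' t))) \<partial>lborel)" .
  have "ennreal (1 / 2) * (\<integral>\<^sup>+ t. ennreal ((cmod (g t))\<^sup>2) \<partial>lborel)
      = ennreal (1 / 2 * (LINT t|lborel. (cmod (g t))\<^sup>2))"
    by (subst nn_integral_eq_integral[OF energy], simp, rule ennreal_mult[symmetric]) auto
  with * show ?thesis
    by (simp only: real_norm_def abs_mult)
qed

section \<open>The Plancherel inequality\<close>

definition fourier :: "(real \<Rightarrow> complex) \<Rightarrow> real \<Rightarrow> complex" where
  "fourier h w = (LINT t|lborel. h t * iexp (- (w * t)))"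

lemma measurable_fourier [measurable]:
  assumes [measurable]: "h \<in> borel_measurable borel"
  shows "fourier h \<in> borel_measurable borel"
  unfolding fourier_def[abs_def] by measurable

lemma integrable_mult_iexp:
  assumes "integrable lborel h" "x \<in> borel_measurable borel"
  shows "integrable lborel (\<lambda>t. h t * iexp (x t))"
  by (rule Bochner_Integration.integrable_bound[OF assms(1)]) (use assms in \<open>auto simp: norm_mult\<close>)

lemma norm_fourier_le: "cmod (fourier h w) \<le> (LINT t|lborel. cmod (h t))"
  using integral_norm_bound[of lborel "\<lambda>t. h t * iexp (- (w * t))"] by (simp add: fourier_def norm_mult)

lemma finite_measure_std_normal: "finite_measure std_normal_distribution"
  using prob_space_normal_density[of 1 0] by (simp add: prob_space.finite_measure)

text \<open>
  Averaging against a Gaussian regularises Fourier inversion: the characteristic function of the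
  normal distribution is again Gaussian, and the substitution \<open>t = s + \<sigma> z\<close> turns the resulting
  integral over \<open>t\<close> into a Gaussian mean of \<open>h\<close> around \<open>s\<close>.
\<close>

lemma gaussian_fourier_inversion:
  assumes h: "integrable lborel h" and \<sigma>: "\<sigma> > 0"
  shows "(LINT v|std_normal_distribution. fourier h (v / \<sigma>) * iexp (v / \<sigma> * s))
    = of_real (\<sigma> * sqrt (2 * pi)) * (LINT z|std_normal_distribution. h (s + \<sigma> * z))"
proof -
  have [measurable]: "h \<in> borel_measurable borel"
    using h by auto
  have "(LINT v|std_normal_distribution. fourier h (v / \<sigma>) * iexp (v / \<sigma> * s))
      = (LINT v|std_normal_distribution. LINT t|lborel. h t * iexp ((s - t) / \<sigma> * v))"
  proof (rule Bochner_Integration.integral_cong[OF refl])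
    fix v
    have "fourier h (v / \<sigma>) * iexp (v / \<sigma> * s)
        = (LINT t|lborel. h t * iexp (- (v / \<sigma> * t)) * iexp (v / \<sigma> * s))"
      unfolding fourier_def
      by (intro integral_mult_left_zero[symmetric])
    also have "\<dots> = (LINT t|lborel. h t * iexp ((s - t) / \<sigma> * v))"
      by (intro Bochner_Integration.integral_cong)
         (simp_all add: mult.assoc exp_add[symmetric] ring_distribs diff_divide_distrib mult.commute)
    finally show "fourier h (v / \<sigma>) * iexp (v / \<sigma> * s) = (LINT t|lborel. h t * iexp ((s - t) / \<sigma> * v))" .
  qed
  also have "\<dots> = (LINT t|lborel. LINT v|std_normal_distribution. h t * iexp ((s - t) / \<sigma> * v))"
  proof (rule swap_integrals_of_uniform_bound[OF finite_measure_std_normal sigma_finite_lborel])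
    show "integrable lborel (\<lambda>t. h t * iexp ((s - t) / \<sigma> * v))" for v
      by (rule integrable_mult_iexp[OF h]) measurable
    show "(LINT t|lborel. cmod (h t * iexp ((s - t) / \<sigma> * v))) \<le> (LINT t|lborel. cmod (h t))" for v
      by (simp add: norm_mult)
  qed measurable
  also have "\<dots> = (LINT t|lborel. h t * exp (- (((s - t) / \<sigma>)\<^sup>2 / 2)))"
    by (simp only: integral_mult_right_zero char_std_normal_distribution[unfolded char_def fun_eq_iff, rule_format] of_real_exp minus_divide_left)
  also have "\<dots> = \<sigma> *\<^sub>R (LINT z|lborel. h (s + \<sigma> * z) * exp (- (z\<^sup>2 / 2)))"
    using \<sigma> by (subst lborel_integral_real_affine[of \<sigma> _ s]) (simp_all add: power_divide power_mult_distrib)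
  also have "(LINT z|lborel. h (s + \<sigma> * z) * exp (- (z\<^sup>2 / 2)))
      = (LINT z|lborel. sqrt (2 * pi) *\<^sub>R (std_normal_density z *\<^sub>R h (s + \<sigma> * z)))"
    by (intro Bochner_Integration.integral_cong)
       (simp_all add: std_normal_density_def scaleR_conv_of_real mult.commute flip: exp_of_real)
  also have "\<dots> = sqrt (2 * pi) *\<^sub>R (LINT z|std_normal_distribution. h (s + \<sigma> * z))"
    by (subst integral_density) (auto simp: normal_density_nonneg simp del: scaleR_scaleR)
  finally show ?thesis
    by (simp add: scaleR_conv_of_real)
qed

text \<open>
  Expand one of the two factors of \<open>|fourier h|\<^sup>2\<close> as an integral and apply the regularised
  inversion formula to the other one.
\<close>

lemma gaussian_plancherel:
  assumes h: "integrable lborel h" and \<sigma>: "\<sigma> > 0"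
  shows "(LINT v|std_normal_distribution. (cmod (fourier h (v / \<sigma>)))\<^sup>2)
    = \<sigma> * sqrt (2 * pi) * Re (LINT s|lborel. cnj (h s) * (LINT z|std_normal_distribution. h (s + \<sigma> * z)))"
proof -
  have [measurable]: "h \<in> borel_measurable borel"
    using h by auto
  define C where "C = (LINT t|lborel. cmod (h t))"
  have "of_real (LINT v|std_normal_distribution. (cmod (fourier h (v / \<sigma>)))\<^sup>2)
      = (LINT v|std_normal_distribution. LINT s|lborel. cnj (h s) * (fourier h (v / \<sigma>) * iexp (v / \<sigma> * s)))"
    unfolding integral_complex_of_real[symmetric]
  proof (rule Bochner_Integration.integral_cong[OF refl])
    fix v
    have "complex_of_real ((cmod (fourier h (v / \<sigma>)))\<^sup>2)
        = cnj (fourier h (v / \<sigma>)) * fourier h (v / \<sigma>)"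
      by (simp only: complex_norm_square mult.commute)
    also have "cnj (fourier h (v / \<sigma>)) = (LINT s|lborel. cnj (h s) * iexp (v / \<sigma> * s))"
      by (simp add: fourier_def exp_cnj flip: Bochner_Integration.integral_cnj)
    also have "\<dots> * fourier h (v / \<sigma>)
        = (LINT s|lborel. cnj (h s) * iexp (v / \<sigma> * s) * fourier h (v / \<sigma>))"
      by (intro integral_mult_left_zero[symmetric])
    finally show "complex_of_real ((cmod (fourier h (v / \<sigma>)))\<^sup>2)
        = (LINT s|lborel. cnj (h s) * (fourier h (v / \<sigma>) * iexp (v / \<sigma> * s)))"
      by (simp add: ac_simps)
  qed
  also have "\<dots> = (LINT s|lborel. LINT v|std_normal_distribution.
      cnj (h s) * (fourier h (v / \<sigma>) * iexp (v / \<sigma> * s)))"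
  proof (rule swap_integrals_of_uniform_bound[OF finite_measure_std_normal sigma_finite_lborel])
    show "integrable lborel (\<lambda>s. cnj (h s) * (fourier h (v / \<sigma>) * iexp (v / \<sigma> * s)))" for v
      by (subst mult.left_commute, rule integrable_mult_right, rule integrable_mult_iexp) (use h in auto)
    show "(LINT s|lborel. cmod (cnj (h s) * (fourier h (v / \<sigma>) * iexp (v / \<sigma> * s)))) \<le> C * C" for v
      using norm_fourier_le[of h "v / \<sigma>"] 
      by (auto simp: norm_mult C_def intro!: mult_left_mono integral_nonneg_AE)
  qed measurable
  also have "\<dots> = (LINT s|lborel. of_real (\<sigma> * sqrt (2 * pi)) *
      (cnj (h s) * (LINT z|std_normal_distribution. h (s + \<sigma> * z))))"
    by (simp only: integral_mult_right_zero gaussian_fourier_inversion[OF h \<sigma>] mult.left_commute)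
  also have "\<dots> = of_real (\<sigma> * sqrt (2 * pi)) *
      (LINT s|lborel. cnj (h s) * (LINT z|std_normal_distribution. h (s + \<sigma> * z)))"
    by (rule integral_mult_right_zero)
  finally have "Re (of_real (LINT v|std_normal_distribution. (cmod (fourier h (v / \<sigma>)))\<^sup>2))
     = Re (of_real (\<sigma> * sqrt (2 * pi)) *
      (LINT s|lborel. cnj (h s) * (LINT z|std_normal_distribution. h (s + \<sigma> * z))))"
    by (rule arg_cong)
  then show ?thesis
    unfolding Re_complex_of_real times_complex.sel Im_complex_of_real by simp
qed

text \<open>
  Continuity gives pointwise convergence of the Gaussian means to \<open>h\<close>; boundedness supplies a
  dominating function both for these means and for the outer integral.
\<close>

lemma energy_as_limit_of_smoothed_correlations:
  assumes h: "integrable lborel h" and cont: "continuous_on UNIV h"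
    and bound: "\<And>t. cmod (h t) \<le> B" and \<sigma>: "\<sigma> \<longlonglongrightarrow> (0::real)"
  shows "(\<lambda>n. LINT s|lborel. cnj (h s) * (LINT z|std_normal_distribution. h (s + \<sigma> n * z)))
    \<longlonglongrightarrow> (LINT s|lborel. cnj (h s) * h s)"
proof (rule integral_dominated_convergence[where w = "\<lambda>s. cmod (h s) * B"])
  interpret N: finite_measure std_normal_distribution
    by (rule finite_measure_std_normal)
  have N: "prob_space std_normal_distribution"
    using prob_space_normal_density[of 1 0] by simp
  have [measurable]: "h \<in> borel_measurable borel"
    using h by auto
  show "(\<lambda>s. cnj (h s) * h s) \<in> borel_measurable lborel"
    by measurable
  show "(\<lambda>s. cnj (h s) * (LINT z|std_normal_distribution. h (s + \<sigma> n * z))) \<in> borel_measurable lborel" for n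
    by measurable
  show "integrable lborel (\<lambda>s. cmod (h s) * B)"
    using h by auto
  have avg: "(\<lambda>n. LINT z|std_normal_distribution. h (s + \<sigma> n * z)) \<longlonglongrightarrow> h s" for s
  proof -
    have "(\<lambda>n. LINT z|std_normal_distribution. h (s + \<sigma> n * z))
        \<longlonglongrightarrow> (LINT z|std_normal_distribution. h s)"
    proof (rule integral_dominated_convergence[where w = "\<lambda>_. B"])
      show "AE z in std_normal_distribution. (\<lambda>n. h (s + \<sigma> n * z)) \<longlonglongrightarrow> h s"
      proof (rule AE_I2)
        fix z
        have "(\<lambda>n. s + \<sigma> n * z) \<longlonglongrightarrow> s + 0 * z"
          by (intro tendsto_intros \<sigma>)
        then show "(\<lambda>n. h (s + \<sigma> n * z)) \<longlonglongrightarrow> h s"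
          using cont by (auto simp: continuous_on_eq_continuous_at intro: isCont_tendsto_compose)
      qed
    qed (use bound in auto)
    then show ?thesis
      using prob_space.prob_space[OF N] by simp
  qed
  show "AE s in lborel. (\<lambda>n. cnj (h s) * (LINT z|std_normal_distribution. h (s + \<sigma> n * z)))
      \<longlonglongrightarrow> cnj (h s) * h s"
    by (intro AE_I2 tendsto_mult tendsto_const avg)
  have "cmod (LINT z|std_normal_distribution. h (s + \<sigma> n * z)) \<le> B" for s n
  proof -
    have "cmod (LINT z|std_normal_distribution. h (s + \<sigma> n * z))
        \<le> (LINT z|std_normal_distribution. cmod (h (s + \<sigma> n * z)))"
      by (rule integral_norm_bound)
    also have "\<dots> \<le> (LINT z|std_normal_distribution. B)"
      by (rule integral_mono) (use bound in \<open>auto intro!: N.integrable_const_bound[where B = B]\<close>)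
    finally show ?thesis
      using prob_space.prob_space[OF N] by simp
  qed
  then show "AE s in lborel. norm (cnj (h s) * (LINT z|std_normal_distribution. h (s + \<sigma> n * z)))
      \<le> cmod (h s) * B" for n
    by (auto simp: norm_mult intro!: mult_left_mono)
qed

text \<open>
  The regularised identity has the weight \<open>exp (- v\<^sup>2 / 2) \<le> 1\<close> on the Fourier side, so dropping
  the weight and letting \<open>\<sigma>\<close> tend to \<open>0\<close> gives one half of Plancherel's theorem, even when the
  right-hand side is infinite.
\<close>

lemma plancherel_le:
  assumes h: "integrable lborel h" and cont: "continuous_on UNIV h"
    and bound: "\<And>t. cmod (h t) \<le> B"
  shows "ennreal (2 * pi) * (\<integral>\<^sup>+ t. ennreal ((cmod (h t))\<^sup>2) \<partial>lborel)
    \<le> (\<integral>\<^sup>+ w. ennreal ((cmod (fourier h w))\<^sup>2) \<partial>lborel)"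
    (is "_ \<le> ?E")
proof -
  interpret N: finite_measure std_normal_distribution
    by (rule finite_measure_std_normal)
  have [measurable]: "h \<in> borel_measurable borel"
    using h by auto
  define A where "A \<sigma> = Re (LINT s|lborel. cnj (h s) * (LINT z|std_normal_distribution. h (s + \<sigma> * z)))"
    for \<sigma> :: real
  define C where "C = (LINT t|lborel. cmod (h t))"
  have A_le: "ennreal (2 * pi * A \<sigma>) \<le> ?E" if \<sigma>: "\<sigma> > 0" for \<sigma>
  proof -
    \<comment> \<open>The factor \<open>sqrt (2 * pi)\<close> normalises the Gaussian weight to have maximum \<open>1\<close>.\<close>
    have "ennreal (sqrt (2 * pi) * (LINT v|std_normal_distribution. (cmod (fourier h (v / \<sigma>)))\<^sup>2))
        = ennreal (sqrt (2 * pi)) * (\<integral>\<^sup>+ v. ennreal ((cmod (fourier h (v / \<sigma>)))\<^sup>2) \<partial>std_normal_distribution)"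
    proof (subst nn_integral_eq_integral)
      show "integrable std_normal_distribution (\<lambda>v. (cmod (fourier h (v / \<sigma>)))\<^sup>2)"
        by (rule N.integrable_const_bound[where B = "C\<^sup>2"])
           (use norm_fourier_le[of h] in \<open>auto simp: C_def intro!: power_mono\<close>)
    qed (auto simp: ennreal_mult')
    also have "\<dots> = (\<integral>\<^sup>+ v. ennreal (sqrt (2 * pi)) * (ennreal (std_normal_density v) * ennreal ((cmod (fourier h (v / \<sigma>)))\<^sup>2)) \<partial>lborel)"
      by (simp add: nn_integral_density nn_integral_cmult)
    also have "\<dots> \<le> (\<integral>\<^sup>+ v. ennreal ((cmod (fourier h (v / \<sigma>)))\<^sup>2) \<partial>lborel)"
    proof (rule nn_integral_mono)
      fix v
      have "sqrt (2 * pi) * (std_normal_density v * (cmod (fourier h (v / \<sigma>)))\<^sup>2)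
          = exp (- v\<^sup>2 / 2) * (cmod (fourier h (v / \<sigma>)))\<^sup>2"
        by (simp add: std_normal_density_def)
      also have "\<dots> \<le> 1 * (cmod (fourier h (v / \<sigma>)))\<^sup>2"
        by (intro mult_right_mono) auto
      finally show "ennreal (sqrt (2 * pi)) * (ennreal (std_normal_density v) * ennreal ((cmod (fourier h (v / \<sigma>)))\<^sup>2))
          \<le> ennreal ((cmod (fourier h (v / \<sigma>)))\<^sup>2)"
        by (simp add: ennreal_mult[symmetric] normal_density_nonneg ennreal_leI)
    qed
    also have "\<dots> = ennreal \<sigma> * ?E"
      using \<sigma> by (subst nn_integral_real_affine[of _ \<sigma> 0]) simp_all
    finally have "ennreal (sqrt (2 * pi) * (\<sigma> * sqrt (2 * pi) * A \<sigma>)) \<le> ennreal \<sigma> * ?E"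
      by (simp only: gaussian_plancherel[OF h \<sigma>] A_def)
    also have "sqrt (2 * pi) * (\<sigma> * sqrt (2 * pi) * A \<sigma>) = \<sigma> * ((sqrt (2 * pi))\<^sup>2 * A \<sigma>)"
      by (simp only: power2_eq_square ac_simps)
    finally have "ennreal \<sigma> * ennreal (2 * pi * A \<sigma>) \<le> ennreal \<sigma> * ?E"
      using \<sigma> by (simp add: ennreal_mult'[symmetric])
    then show ?thesis
      using \<sigma> by (subst (asm) ennreal_mult_le_mult_iff) auto
  qed
  define \<sigma> where "\<sigma> n = inverse (real (Suc n))" for n
  have "\<sigma> \<longlonglongrightarrow> 0"
    unfolding \<sigma>_def by (rule LIMSEQ_inverse_real_of_nat)
  then have "(\<lambda>n. A (\<sigma> n)) \<longlonglongrightarrow> Re (LINT s|lborel. cnj (h s) * h s)"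
    unfolding A_def by (intro tendsto_Re energy_as_limit_of_smoothed_correlations[OF h cont bound])
  also have "(LINT s|lborel. cnj (h s) * h s) = of_real (LINT s|lborel. (cmod (h s))\<^sup>2)"
    unfolding integral_complex_of_real[symmetric]
    by (intro Bochner_Integration.integral_cong) (simp_all only: complex_norm_square mult.commute)
  finally have "(\<lambda>n. ennreal (2 * pi * A (\<sigma> n))) \<longlonglongrightarrow> ennreal (2 * pi * (LINT s|lborel. (cmod (h s))\<^sup>2))"
    by (intro tendsto_ennrealI tendsto_intros) simp
  then have "ennreal (2 * pi * (LINT s|lborel. (cmod (h s))\<^sup>2)) \<le> ?E"
    by (rule LIMSEQ_le_const2) (auto intro!: A_le simp: \<sigma>_def)
  moreover have "integrable lborel (\<lambda>s. (cmod (h s))\<^sup>2)"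
  proof (rule Bochner_Integration.integrable_bound)
    show "integrable lborel (\<lambda>s. B * cmod (h s))"
      using h by auto
    show "AE s in lborel. norm ((cmod (h s))\<^sup>2) \<le> norm (B * cmod (h s))"
      using bound by (auto simp: power2_eq_square abs_mult intro!: mult_right_mono order_trans[OF bound abs_ge_self])
  qed simp
  ultimately show ?thesis
    by (simp add: nn_integral_eq_integral ennreal_mult')
qed

lemma forward_difference_quotient_tendsto:
  assumes "(k has_vector_derivative k') (at t)"
  shows "(\<lambda>n. (k (t + inverse (real (Suc n))) - k t) /\<^sub>R inverse (real (Suc n))) \<longlonglongrightarrow> k'"
proof -
  have "((\<lambda>e. norm (k (t + e) - k t - e *\<^sub>R k') / norm e) \<longlongrightarrow> 0) (at 0)"
    using assms by (simp add: has_vector_derivative_def has_derivative_at)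
  moreover have "\<forall>\<^sub>F e in at 0. norm (k (t + e) - k t - e *\<^sub>R k') / norm e = norm ((k (t + e) - k t) /\<^sub>R e - k')"
  proof -
    have "norm (k (t + e) - k t - e *\<^sub>R k') / norm e = norm ((k (t + e) - k t) /\<^sub>R e - k')" if "e \<noteq> 0" for e
    proof -
      have "(k (t + e) - k t) /\<^sub>R e - k' = (k (t + e) - k t - e *\<^sub>R k') /\<^sub>R e"
        using that by (simp add: scaleR_diff_right)
      then show ?thesis
        by (simp add: divide_inverse_commute)
    qed
    then show ?thesis
      by (auto simp: eventually_at_filter)
  qed
  ultimately have "((\<lambda>e. norm ((k (t + e) - k t) /\<^sub>R e - k')) \<longlongrightarrow> 0) (at 0)"
    by (rule Lim_transform_eventually)
  then have "((\<lambda>e. (k (t + e) - k t) /\<^sub>R e) \<longlongrightarrow> k') (at 0)"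
    by (simp add: tendsto_norm_zero_iff LIM_zero_cancel)
  moreover have "filterlim (\<lambda>n. inverse (real (Suc n))) (at 0) sequentially"
    unfolding filterlim_at using LIMSEQ_inverse_real_of_nat by auto
  ultimately show ?thesis
    by (rule filterlim_compose)
qed

text \<open>
  The derivative \<open>k'\<close> may fail to be integrable, so it has no Fourier integral of its own.
  The difference quotients of \<open>k\<close> do have one, namely \<open>fourier k\<close> times a multiplier of modulus at
  most \<open>|w|\<close>; Fatou's lemma passes to the limit.
\<close>

lemma plancherel_derivative_le:
  assumes k: "integrable lborel k" and deriv: "\<And>t. (k has_vector_derivative k' t) (at t)"
    and bound: "\<And>t. cmod (k t) \<le> B"
  shows "ennreal (2 * pi) * (\<integral>\<^sup>+ t. ennreal ((cmod (k' t))\<^sup>2) \<partial>lborel)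
    \<le> (\<integral>\<^sup>+ w. ennreal (w\<^sup>2 * (cmod (fourier k w))\<^sup>2) \<partial>lborel)"
    (is "_ \<le> ?E")
proof -
  have [measurable]: "k \<in> borel_measurable borel"
    using k by auto
  have contk: "continuous_on UNIV k"
    using deriv by (meson continuous_at_imp_continuous_on has_vector_derivative_continuous)
  define \<delta> where "\<delta> n = inverse (real (Suc n))" for n
  have \<delta>: "\<delta> n > 0" for n
    by (simp add: \<delta>_def)
  define D where "D n t = (k (t + \<delta> n) - k t) /\<^sub>R \<delta> n" for n t
  have [measurable]: "D n \<in> borel_measurable borel" for n
    unfolding D_def by measurable
  have D_lim: "(\<lambda>n. D n t) \<longlonglongrightarrow> k' t" for t
    unfolding D_def \<delta>_def by (rule forward_difference_quotient_tendsto[OF deriv])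
  have D_le: "ennreal (2 * pi) * (\<integral>\<^sup>+ t. ennreal ((cmod (D n t))\<^sup>2) \<partial>lborel) \<le> ?E" for n
  proof -
    have shift: "integrable lborel (\<lambda>t. k (t + \<delta> n))"
      using lborel_integrable_real_affine[OF k, of 1 "\<delta> n"] by (simp add: add.commute)
    have "ennreal (2 * pi) * (\<integral>\<^sup>+ t. ennreal ((cmod (D n t))\<^sup>2) \<partial>lborel)
        \<le> (\<integral>\<^sup>+ w. ennreal ((cmod (fourier (D n) w))\<^sup>2) \<partial>lborel)"
    proof (rule plancherel_le)
      show "integrable lborel (D n)"
        unfolding D_def using shift k by auto
      show "continuous_on UNIV (D n)"
        unfolding D_def by (intro continuous_intros continuous_on_compose2[OF contk]) auto
      show "cmod (D n t) \<le> (B + B) / \<delta> n" for t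
        using norm_triangle_mono[OF norm_triangle_ineq4[of "k (t + \<delta> n)" "k t", THEN order_trans], of "B + B"]
          add_mono[OF bound[of "t + \<delta> n"] bound[of t]] norm_triangle_ineq4[of "k (t + \<delta> n)" "k t"] \<delta>[of n]
        by (simp add: D_def divide_inverse_commute mult_left_mono)
    qed
    also have "\<dots> \<le> ?E"
    proof (intro nn_integral_mono ennreal_leI)
      fix w
      have "(LINT t|lborel. k (t + \<delta> n) * iexp (- (w * t)))
          = (LINT t|lborel. k t * iexp (- (w * (t - \<delta> n))))"
        using lborel_integral_real_affine[of 1 "\<lambda>t. k t * iexp (- (w * (t - \<delta> n)))" "\<delta> n"]
        by (simp add: add.commute)
      also have "\<dots> = (LINT t|lborel. iexp (w * \<delta> n) * (k t * iexp (- (w * t))))"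
        by (intro Bochner_Integration.integral_cong)
           (simp_all add: algebra_simps exp_add[symmetric] exp_diff exp_minus divide_inverse)
      also have "\<dots> = iexp (w * \<delta> n) * fourier k w"
        unfolding fourier_def by (rule integral_mult_right_zero)
      finally have shifted: "(LINT t|lborel. k (t + \<delta> n) * iexp (- (w * t))) = iexp (w * \<delta> n) * fourier k w" .
      have "fourier (D n) w = (LINT t|lborel. (k (t + \<delta> n) * iexp (- (w * t)) - k t * iexp (- (w * t))) /\<^sub>R \<delta> n)"
        unfolding fourier_def D_def by (simp add: algebra_simps)
      also have "\<dots> = (iexp (w * \<delta> n) - 1) * fourier k w /\<^sub>R \<delta> n"
        unfolding integral_scaleR_right
      proof (subst Bochner_Integration.integral_diff)
        show "((LINT t|lborel. k (t + \<delta> n) * iexp (- (w * t))) - (LINT t|lborel. k t * iexp (- (w * t)))) /\<^sub>R \<delta> n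
            = (iexp (w * \<delta> n) - 1) * fourier k w /\<^sub>R \<delta> n"
          unfolding shifted fourier_def[of k, symmetric] by (simp add: ring_distribs)
      qed (rule integrable_mult_iexp[OF shift] integrable_mult_iexp[OF k], measurable)+
      finally have "cmod (fourier (D n) w) = cmod (iexp (w * \<delta> n) - 1) / \<delta> n * cmod (fourier k w)"
        using \<delta>[of n] by (simp add: norm_mult divide_inverse)
      also have "\<dots> \<le> \<bar>w\<bar> * cmod (fourier k w)"
        using iexp_approx1[of "w * \<delta> n" 0] \<delta>[of n]
        by (intro mult_right_mono) (auto simp: abs_mult field_simps)
      finally have "(cmod (fourier (D n) w))\<^sup>2 \<le> (\<bar>w\<bar> * cmod (fourier k w))\<^sup>2"
        by (rule power_mono) simp
      then show "(cmod (fourier (D n) w))\<^sup>2 \<le> w\<^sup>2 * (cmod (fourier k w))\<^sup>2"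
        by (simp add: power_mult_distrib)
    qed
    finally show ?thesis .
  qed
  have "ennreal (2 * pi) * (\<integral>\<^sup>+ t. ennreal ((cmod (k' t))\<^sup>2) \<partial>lborel)
      = (\<integral>\<^sup>+ t. liminf (\<lambda>n. ennreal (2 * pi) * ennreal ((cmod (D n t))\<^sup>2)) \<partial>lborel)"
  proof (subst nn_integral_cmult[symmetric])
    have "k' \<in> borel_measurable borel"
      by (rule borel_measurable_LIMSEQ_metric[OF _ D_lim]) measurable
    then show "(\<lambda>t. ennreal ((cmod (k' t))\<^sup>2)) \<in> borel_measurable lborel"
      by measurable
    have "liminf (\<lambda>n. ennreal (2 * pi) * ennreal ((cmod (D n t))\<^sup>2))
        = ennreal (2 * pi) * ennreal ((cmod (k' t))\<^sup>2)" for t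
      by (intro lim_imp_Liminf ennreal_tendsto_cmult tendsto_ennrealI tendsto_intros D_lim) auto
    then show "(\<integral>\<^sup>+ t. ennreal (2 * pi) * ennreal ((cmod (k' t))\<^sup>2) \<partial>lborel)
        = (\<integral>\<^sup>+ t. liminf (\<lambda>n. ennreal (2 * pi) * ennreal ((cmod (D n t))\<^sup>2)) \<partial>lborel)"
      by (simp only:)
  qed
  also have "\<dots> \<le> liminf (\<lambda>n. \<integral>\<^sup>+ t. ennreal (2 * pi) * ennreal ((cmod (D n t))\<^sup>2) \<partial>lborel)"
    by (rule nn_integral_liminf) measurable
  also have "\<dots> \<le> ?E"
    using D_le by (intro Liminf_le) (auto simp: nn_integral_cmult)
  finally show ?thesis .
qed

section \<open>Second moments of the linear canonical transform\<close>

text \<open>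
  The transform is the Fourier transform of a chirped signal, up to scaling and a unimodular
  factor. Including the frequency \<open>- \<mu> / b\<close> in the chirp moves the centre of the spectrum, which
  reduces the moment about \<open>\<mu>\<close> to the moment about \<open>0\<close>.
\<close>

lemma cmod_lct_sq:
  fixes a b c d u \<mu> :: real and g :: "real \<Rightarrow> complex"
  assumes b: "b \<noteq> 0"
  defines "k \<equiv> \<lambda>t. g t * iexp (a / (2 * b) * t\<^sup>2 - \<mu> / b * t)"
  shows "(cmod (lct a b c d g u))\<^sup>2 = (cmod (fourier k ((u - \<mu>) / b)))\<^sup>2 / (2 * pi * \<bar>b\<bar>)"
proof -
  define C where "C = 1 / csqrt (\<i> * of_real (2 * pi * b)) * iexp (d / (2 * b) * u\<^sup>2)"
  have "lct a b c d g u = (LINT t|lborel. C * (k t * iexp (- ((u - \<mu>) / b * t))))"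
  proof -
    have "g t * lct_kernel a b d t u = C * (k t * iexp (- ((u - \<mu>) / b * t)))" for t
    proof -
      have "iexp (a / (2 * b) * t\<^sup>2 - 1 / b * (t * u) + d / (2 * b) * u\<^sup>2)
          = iexp (d / (2 * b) * u\<^sup>2 + ((a / (2 * b) * t\<^sup>2 - \<mu> / b * t) + - ((u - \<mu>) / b * t)))"
        by (rule arg_cong[where f = iexp]) (simp add: diff_divide_distrib algebra_simps)
      also have "\<dots> = iexp (d / (2 * b) * u\<^sup>2) * (iexp (a / (2 * b) * t\<^sup>2 - \<mu> / b * t) * iexp (- ((u - \<mu>) / b * t)))"
        by (simp only: of_real_add distrib_left exp_add)
      finally show ?thesis
        by (simp only: lct_kernel_def C_def k_def ac_simps)
    qed
    then show ?thesis
      using b by (simp only: lct_def if_True simp_thms)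
  qed
  also have "\<dots> = C * fourier k ((u - \<mu>) / b)"
    unfolding fourier_def by (rule integral_mult_right_zero)
  finally have "cmod (lct a b c d g u) = cmod C * cmod (fourier k ((u - \<mu>) / b))"
    by (simp only: norm_mult)
  moreover have "(cmod C)\<^sup>2 = 1 / (2 * pi * \<bar>b\<bar>)"
  proof -
    have "(cmod (csqrt (\<i> * of_real (2 * pi * b))))\<^sup>2 = cmod (\<i> * of_real (2 * pi * b))"
      by (simp only: norm_power[symmetric] power2_csqrt)
    also have "\<dots> = 2 * pi * \<bar>b\<bar>"
      by (simp add: norm_mult)
    finally show ?thesis
      by (simp only: C_def norm_mult norm_divide norm_one norm_exp_i_times power_mult_distrib power_divide power_one mult_1_right)
  qed
  ultimately show ?thesis
    by (simp add: power_mult_distrib)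
qed

text \<open>
  In the time domain, multiplication of the transform by \<open>u - \<mu>\<close> is, up to a unit, the operator
  \<open>b g' + \<i> (a t - \<mu>) g\<close>. For \<open>b = 0\<close> the transform is a dilation by \<open>d = 1 / a\<close>, and
  equality holds by substitution; for \<open>b \<noteq> 0\<close> this is the Plancherel inequality for the derivative
  of the chirped signal.
\<close>

lemma lct_second_moment_ge:
  fixes a b c d \<mu> :: real
  assumes det: "a * d - b * c = 1"
    and deriv: "\<And>t. (g has_vector_derivative g' t) (at t)" and g' [measurable]: "g' \<in> borel_measurable borel"
    and g: "integrable lborel g" and bound: "\<And>t. cmod (g t) \<le> B"
  shows "(\<integral>\<^sup>+ t. ennreal ((cmod (of_real b * g' t + \<i> * of_real (a * t - \<mu>) * g t))\<^sup>2) \<partial>lborel)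
    \<le> (\<integral>\<^sup>+ u. ennreal ((u - \<mu>)\<^sup>2 * (cmod (lct a b c d g u))\<^sup>2) \<partial>lborel)"
proof (cases "b = 0")
  case True
  then have ad: "a * d = 1"
    using det by simp
  then have d: "d \<noteq> 0" by auto
  have [measurable]: "g \<in> borel_measurable borel"
    using g by auto
  have "(\<integral>\<^sup>+ t. ennreal ((a * t - \<mu>)\<^sup>2 * (cmod (g t))\<^sup>2) \<partial>lborel)
      = ennreal \<bar>d\<bar> * (\<integral>\<^sup>+ u. ennreal ((u - \<mu>)\<^sup>2 * (cmod (g (d * u)))\<^sup>2) \<partial>lborel)"
    using d ad by (subst nn_integral_real_affine[of _ d 0]) (simp_all flip: mult.assoc)
  also have "\<dots> = (\<integral>\<^sup>+ u. ennreal ((u - \<mu>)\<^sup>2 * (cmod (lct a b c d g u))\<^sup>2) \<partial>lborel)"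
  proof (subst nn_integral_cmult[symmetric])
    have "(cmod (csqrt (of_real d)))\<^sup>2 = \<bar>d\<bar>"
      by (simp only: norm_power[symmetric] power2_csqrt norm_of_real)
    then have "(cmod (lct a b c d g u))\<^sup>2 = \<bar>d\<bar> * (cmod (g (d * u)))\<^sup>2" for u
      using True by (simp only: lct_def simp_thms if_False norm_mult norm_exp_i_times power_mult_distrib power_one mult_1_right)
    then show "(\<integral>\<^sup>+ u. ennreal \<bar>d\<bar> * ennreal ((u - \<mu>)\<^sup>2 * (cmod (g (d * u)))\<^sup>2) \<partial>lborel)
        = (\<integral>\<^sup>+ u. ennreal ((u - \<mu>)\<^sup>2 * (cmod (lct a b c d g u))\<^sup>2) \<partial>lborel)"
      by (simp add: ennreal_mult'[symmetric] mult.left_commute)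
  qed simp
  finally show ?thesis
    using True by (simp add: norm_mult power_mult_distrib flip: of_real_mult of_real_diff)
next
  case False
  define \<phi> where "\<phi> t = a / (2 * b) * t\<^sup>2 - \<mu> / b * t" for t
  define k where "k t = g t * iexp (\<phi> t)" for t
  define k' where "k' t = g t * (of_real (a / b * t - \<mu> / b) * (\<i> * iexp (\<phi> t))) + g' t * iexp (\<phi> t)" for t
  have [measurable]: "g \<in> borel_measurable borel"
    using g by auto
  have [measurable]: "k \<in> borel_measurable borel"
    unfolding k_def \<phi>_def by measurable
  have "ennreal (2 * pi) * (\<integral>\<^sup>+ t. ennreal ((cmod (k' t))\<^sup>2) \<partial>lborel)
      \<le> (\<integral>\<^sup>+ w. ennreal (w\<^sup>2 * (cmod (fourier k w))\<^sup>2) \<partial>lborel)"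
  proof (rule plancherel_derivative_le)
    show "integrable lborel k"
      unfolding k_def \<phi>_def by (rule integrable_mult_iexp[OF g]) measurable
    show "cmod (k t) \<le> B" for t
      using bound by (simp add: k_def norm_mult)
    fix t
    have "(\<phi> has_real_derivative (a / b * t - \<mu> / b)) (at t)"
      unfolding \<phi>_def using False by (auto intro!: derivative_eq_intros simp: field_simps)
    moreover have "((\<lambda>x. iexp x) has_vector_derivative \<i> * iexp (\<phi> t)) (at (\<phi> t))"
      by (rule has_vector_derivative_real_field) (auto intro!: derivative_eq_intros)
    ultimately have "((\<lambda>t. iexp (\<phi> t)) has_vector_derivative (a / b * t - \<mu> / b) *\<^sub>R (\<i> * iexp (\<phi> t))) (at t)"
      using vector_diff_chain_at[of \<phi> "a / b * t - \<mu> / b" t "\<lambda>x. iexp x"]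
      by (simp add: has_real_derivative_iff_has_vector_derivative o_def)
    from has_vector_derivative_mult[OF deriv this]
    show "(k has_vector_derivative k' t) (at t)"
      by (simp only: k_def[abs_def] k'_def scaleR_conv_of_real)
  qed
  note k_le = this
  have k'_sq: "b\<^sup>2 * (cmod (k' t))\<^sup>2 = (cmod (of_real b * g' t + \<i> * of_real (a * t - \<mu>) * g t))\<^sup>2" for t
  proof -
    have "of_real b * k' t = (of_real b * g' t + \<i> * of_real (a * t - \<mu>) * g t) * iexp (\<phi> t)"
      using False by (simp add: k'_def field_simps)
    then have "cmod (of_real b * k' t) = cmod (of_real b * g' t + \<i> * of_real (a * t - \<mu>) * g t)"
      by (simp only: norm_mult norm_exp_i_times mult_1_right)
    then show ?thesis
      by (metis norm_mult norm_of_real power2_abs power_mult_distrib)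
  qed
  have lct_eq: "ennreal (2 * pi) * (\<integral>\<^sup>+ u. ennreal ((u - \<mu>)\<^sup>2 * (cmod (lct a b c d g u))\<^sup>2) \<partial>lborel)
      = ennreal (b\<^sup>2) * (\<integral>\<^sup>+ w. ennreal (w\<^sup>2 * (cmod (fourier k w))\<^sup>2) \<partial>lborel)"
  proof -
    have "(\<integral>\<^sup>+ u. ennreal ((u - \<mu>)\<^sup>2 * (cmod (lct a b c d g u))\<^sup>2) \<partial>lborel)
        = (\<integral>\<^sup>+ u. ennreal ((u - \<mu>)\<^sup>2 * ((cmod (fourier k ((u - \<mu>) / b)))\<^sup>2 / (2 * pi * \<bar>b\<bar>))) \<partial>lborel)"
      using cmod_lct_sq[OF False, of a c d g _ \<mu>] by (simp only: k_def[abs_def] \<phi>_def)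
    also have "\<dots> = ennreal \<bar>b\<bar> * (\<integral>\<^sup>+ w. ennreal ((b * w)\<^sup>2 * ((cmod (fourier k w))\<^sup>2 / (2 * pi * \<bar>b\<bar>))) \<partial>lborel)"
      using False by (subst nn_integral_real_affine[of _ b \<mu>]) simp_all
    finally have "ennreal (2 * pi) * (\<integral>\<^sup>+ u. ennreal ((u - \<mu>)\<^sup>2 * (cmod (lct a b c d g u))\<^sup>2) \<partial>lborel)
        = ennreal (2 * pi * \<bar>b\<bar>) * (\<integral>\<^sup>+ w. ennreal ((b * w)\<^sup>2 * ((cmod (fourier k w))\<^sup>2 / (2 * pi * \<bar>b\<bar>))) \<partial>lborel)"
      by (simp add: ennreal_mult mult.assoc)
    also have "\<dots> = (\<integral>\<^sup>+ w. ennreal (b\<^sup>2) * ennreal (w\<^sup>2 * (cmod (fourier k w))\<^sup>2) \<partial>lborel)"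
      using False
      by (subst nn_integral_cmult[symmetric])
         (auto simp: ennreal_mult[symmetric] power_mult_distrib intro!: nn_integral_cong)
    finally show ?thesis
      by (simp add: nn_integral_cmult)
  qed
  have [measurable]: "k' \<in> borel_measurable borel"
    unfolding k'_def \<phi>_def by measurable
  have "ennreal (2 * pi) * (\<integral>\<^sup>+ t. ennreal ((cmod (of_real b * g' t + \<i> * of_real (a * t - \<mu>) * g t))\<^sup>2) \<partial>lborel)
      = ennreal (b\<^sup>2) * (ennreal (2 * pi) * (\<integral>\<^sup>+ t. ennreal ((cmod (k' t))\<^sup>2) \<partial>lborel))"
    unfolding k'_sq[symmetric]
    by (subst mult.left_commute, subst nn_integral_cmult[symmetric]) (simp_all add: ennreal_mult)
  also have "\<dots> \<le> ennreal (2 * pi) * (\<integral>\<^sup>+ u. ennreal ((u - \<mu>)\<^sup>2 * (cmod (lct a b c d g u))\<^sup>2) \<partial>lborel)"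
    unfolding lct_eq by (intro mult_left_mono k_le) simp
  finally show ?thesis
    by (subst (asm) ennreal_mult_le_mult_iff) auto
qed

section \<open>The uncertainty inequality for random signals\<close>

lemma bounded_of_continuous_tendsto_0:
  fixes g :: "real \<Rightarrow> complex"
  assumes cont: "continuous_on UNIV g" and lim: "(g \<longlongrightarrow> 0) at_infinity"
  obtains B where "\<And>t. cmod (g t) \<le> B"
proof -
  have "\<forall>\<^sub>F t in at_infinity. cmod (g t) < 1"
    using tendstoD[OF lim, of 1] by simp
  then obtain R where R: "\<And>t. R \<le> norm t \<Longrightarrow> cmod (g t) < 1"
    by (auto simp: eventually_at_infinity)
  have "compact (g ` cball 0 R)"
    by (intro compact_continuous_image continuous_on_subset[OF cont]) auto
  then obtain C where C: "\<And>t. t \<in> cball 0 R \<Longrightarrow> cmod (g t) \<le> C"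
    by (metis compact_imp_bounded bounded_iff imageI)
  have "cmod (g t) \<le> max C 1" for t
    using R[of t] C[of t] by (cases "R \<le> norm t") auto
  then show thesis by (rule that)
qed

text \<open>
  The two terms on the right of the uncertainty inequality come from applying the
  Cauchy--Schwarz inequality separately to the two orthogonal components of \<open>Q\<close>. Working in
  \<open>[0, \<infinity>]\<close> covers infinite and vanishing moments alike.
\<close>

lemma Cauchy_Schwarz_Re_Im:
  assumes [measurable]: "X \<in> borel_measurable M" "Q \<in> borel_measurable M"
  shows "(\<integral>\<^sup>+ x. ennreal (\<bar>X x\<bar> * \<bar>Re (Q x)\<bar>) \<partial>M)\<^sup>2 + (\<integral>\<^sup>+ x. ennreal (\<bar>X x\<bar> * \<bar>Im (Q x)\<bar>) \<partial>M)\<^sup>2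
    \<le> (\<integral>\<^sup>+ x. ennreal ((X x)\<^sup>2) \<partial>M) * (\<integral>\<^sup>+ x. ennreal ((cmod (Q x))\<^sup>2) \<partial>M)"
proof -
  have CS: "(\<integral>\<^sup>+ x. ennreal (\<bar>X x\<bar> * \<bar>Y x\<bar>) \<partial>M)\<^sup>2
      \<le> (\<integral>\<^sup>+ x. ennreal ((X x)\<^sup>2) \<partial>M) * (\<integral>\<^sup>+ x. ennreal ((Y x)\<^sup>2) \<partial>M)"
    if [measurable]: "Y \<in> borel_measurable M" for Y :: "_ \<Rightarrow> real"
    using Cauchy_Schwarz_nn_integral[of "\<lambda>x. ennreal \<bar>X x\<bar>" M "\<lambda>x. ennreal \<bar>Y x\<bar>"]
    by (simp add: ennreal_mult ennreal_power)
  have "(\<integral>\<^sup>+ x. ennreal ((cmod (Q x))\<^sup>2) \<partial>M)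
      = (\<integral>\<^sup>+ x. ennreal ((Re (Q x))\<^sup>2) \<partial>M) + (\<integral>\<^sup>+ x. ennreal ((Im (Q x))\<^sup>2) \<partial>M)"
    by (simp add: cmod_power2 nn_integral_add[symmetric])
  then show ?thesis
    using CS[of "\<lambda>x. Re (Q x)"] CS[of "\<lambda>x. Im (Q x)"]
    by (simp add: distrib_left add_mono)
qed

theorem theorem1:
  fixes P :: "'w measure"
    and \<psi> \<theta> :: "real \<Rightarrow> 'w \<Rightarrow> real"
    and f :: "real \<Rightarrow> 'w \<Rightarrow> complex"
    and a b c d \<mu>\<^sub>t \<mu>\<^sub>u :: real
  assumes "prob_space P"
    and "\<And>t \<eta>. \<eta> \<in> space P \<Longrightarrow> f t \<eta> = of_real (\<psi> t \<eta>) * exp (\<i> * of_real (\<theta> t \<eta>))"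
    and "square_integrable (lborel \<Otimes>\<^sub>M P) (\<lambda>(t, \<eta>). f t \<eta>)"
    and "signal_norm P f = 1"
    and "AE \<eta> in P. square_integrable lborel (\<lambda>t. f t \<eta>)"
    and "AE \<eta> in P. square_integrable lborel (\<lambda>t. of_real t * f t \<eta>)"
    and "AE \<eta> in P. square_integrable lborel (\<lambda>t. vector_derivative (\<lambda>s. f s \<eta>) (at t))"
    and "AE \<eta> in P. (\<lambda>t. \<psi> t \<eta>) C1_differentiable_on UNIV"
    and "AE \<eta> in P. (\<lambda>t. \<theta> t \<eta>) C1_differentiable_on UNIV"
    and "AE \<eta> in P. ((\<lambda>t. f t \<eta>) \<longlongrightarrow> 0) at_infinity"
    and "a * d - b * c = 1"
    and "has_signal_mean P f"
    and "\<mu>\<^sub>t = signal_mean P f"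
    and "has_signal_mean P (signal_lct a b c d f)"
    and "\<mu>\<^sub>u = signal_mean P (signal_lct a b c d f)"
  shows "expected_variance P f * expected_variance P (signal_lct a b c d f)
    \<ge> ennreal (b\<^sup>2 / 4)
      + (\<integral>\<^sup>+ \<eta>. \<integral>\<^sup>+ t. ennreal (\<bar>(t - \<mu>\<^sub>t) * (a * t + b * deriv (\<lambda>s. \<theta> s \<eta>) t - \<mu>\<^sub>u)\<bar> * (\<psi> t \<eta>)\<^sup>2)
           \<partial>lborel \<partial>P)\<^sup>2"
proof -
  \<comment> \<open>The time derivative of the signal, written as a limit of difference quotients in order to be
    jointly measurable in the sample point and the time.\<close>
  define D where "D \<eta> t = lim (\<lambda>n. (f (t + inverse (real (Suc n))) \<eta> - f t \<eta>) /\<^sub>R inverse (real (Suc n)))" for \<eta> t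
  define H where "H \<eta> t = of_real b * D \<eta> t + \<i> * of_real (a * t - \<mu>\<^sub>u) * f t \<eta>" for \<eta> t
  \<comment> \<open>Up to the sign of \<open>\<psi>\<close>, multiplication by the conjugate phase of the signal, which makes the
    amplitude part of \<open>H\<close> real and its phase part imaginary. The zeros of the signal contribute
    nothing to the correlations, and \<open>sgn 0 = 0\<close> removes them.\<close>
  define Q where "Q \<eta> t = cnj (sgn (f t \<eta>)) * H \<eta> t" for \<eta> t
  define X where "X \<eta> t = (t - \<mu>\<^sub>t) * cmod (f t \<eta>)" for \<eta> t
  have f: "(\<lambda>(t, \<eta>). f t \<eta>) \<in> borel_measurable (lborel \<Otimes>\<^sub>M P)"
    using assms(3) by (simp add: square_integrable_def)
  have f_shift [measurable]: "(\<lambda>z. f (snd z + e) (fst z)) \<in> borel_measurable (P \<Otimes>\<^sub>M lborel)" for e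
  proof -
    have "(\<lambda>z. (snd z + e, fst z)) \<in> P \<Otimes>\<^sub>M lborel \<rightarrow>\<^sub>M lborel \<Otimes>\<^sub>M P"
      by measurable
    from measurable_compose[OF this f] show ?thesis by simp
  qed
  from f_shift[of 0] have f_joint [measurable]: "(\<lambda>z. f (snd z) (fst z)) \<in> borel_measurable (P \<Otimes>\<^sub>M lborel)"
    by simp
  have D_meas [measurable]: "(\<lambda>z. D (fst z) (snd z)) \<in> borel_measurable (P \<Otimes>\<^sub>M lborel)"
    unfolding D_def by measurable
  have X_meas [measurable]: "(\<lambda>z. X (fst z) (snd z)) \<in> borel_measurable (P \<Otimes>\<^sub>M lborel)"
    unfolding X_def by measurable
  have Q_meas [measurable]: "(\<lambda>z. Q (fst z) (snd z)) \<in> borel_measurable (P \<Otimes>\<^sub>M lborel)"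
    unfolding Q_def H_def sgn_div_norm by measurable
  have iterated: "(\<integral>\<^sup>+ \<eta>. \<integral>\<^sup>+ t. \<Phi> \<eta> t \<partial>lborel \<partial>P) = (\<integral>\<^sup>+ z. \<Phi> (fst z) (snd z) \<partial>(P \<Otimes>\<^sub>M lborel))"
    if "(\<lambda>z. \<Phi> (fst z) (snd z)) \<in> borel_measurable (P \<Otimes>\<^sub>M lborel)" for \<Phi> :: "'w \<Rightarrow> real \<Rightarrow> ennreal"
    using lborel.nn_integral_fst[OF that] by simp

  have correlation: "\<bar>X \<eta> t\<bar> * \<bar>Re (Q \<eta> t)\<bar> = \<bar>t - \<mu>\<^sub>t\<bar> * \<bar>b\<bar> * \<bar>Re (cnj (f t \<eta>) * D \<eta> t)\<bar>"
    "\<bar>X \<eta> t\<bar> * \<bar>Im (Q \<eta> t)\<bar> = \<bar>t - \<mu>\<^sub>t\<bar> * \<bar>b * Im (cnj (f t \<eta>) * D \<eta> t) + (a * t - \<mu>\<^sub>u) * (cmod (f t \<eta>))\<^sup>2\<bar>" for \<eta> t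
  proof -
    have "of_real (cmod (f t \<eta>)) * Q \<eta> t = cnj (f t \<eta>) * H \<eta> t"
      by (cases "f t \<eta> = 0") (simp_all add: Q_def sgn_div_norm scaleR_conv_of_real)
    also have "\<dots> = of_real b * (cnj (f t \<eta>) * D \<eta> t) + of_real ((a * t - \<mu>\<^sub>u) * (cmod (f t \<eta>))\<^sup>2) * \<i>"
      unfolding of_real_mult complex_norm_square H_def by (simp add: algebra_simps)
    finally have *: "of_real (cmod (f t \<eta>)) * Q \<eta> t = \<dots>" .
    have "cmod (f t \<eta>) * Re (Q \<eta> t) = b * Re (cnj (f t \<eta>) * D \<eta> t)"
      using arg_cong[OF *, of Re] by simp
    then show "\<bar>X \<eta> t\<bar> * \<bar>Re (Q \<eta> t)\<bar> = \<bar>t - \<mu>\<^sub>t\<bar> * \<bar>b\<bar> * \<bar>Re (cnj (f t \<eta>) * D \<eta> t)\<bar>"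
      unfolding X_def by (metis abs_mult mult.assoc)
    have "cmod (f t \<eta>) * Im (Q \<eta> t) = b * Im (cnj (f t \<eta>) * D \<eta> t) + (a * t - \<mu>\<^sub>u) * (cmod (f t \<eta>))\<^sup>2"
      using arg_cong[OF *, of Im] by simp
    then show "\<bar>X \<eta> t\<bar> * \<bar>Im (Q \<eta> t)\<bar> = \<bar>t - \<mu>\<^sub>t\<bar> * \<bar>b * Im (cnj (f t \<eta>) * D \<eta> t) + (a * t - \<mu>\<^sub>u) * (cmod (f t \<eta>))\<^sup>2\<bar>"
      unfolding X_def by (metis abs_mult mult.assoc)
  qed

  \<comment> \<open>Everything that rests on the smoothness of single realisations: the moment bound, integration
    by parts, and the identification of the phase part with the integrand of the covariance.\<close>
  have sample: "AE \<eta> in P.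
      (\<integral>\<^sup>+ t. ennreal ((cmod (Q \<eta> t))\<^sup>2) \<partial>lborel)
        \<le> (\<integral>\<^sup>+ u. ennreal ((u - \<mu>\<^sub>u)\<^sup>2 * (cmod (signal_lct a b c d f u \<eta>))\<^sup>2) \<partial>lborel) \<and>
      ennreal (\<bar>b\<bar> / 2) * (\<integral>\<^sup>+ t. ennreal ((cmod (f t \<eta>))\<^sup>2) \<partial>lborel)
        \<le> (\<integral>\<^sup>+ t. ennreal (\<bar>X \<eta> t\<bar> * \<bar>Re (Q \<eta> t)\<bar>) \<partial>lborel) \<and>
      (\<integral>\<^sup>+ t. ennreal (\<bar>X \<eta> t\<bar> * \<bar>Im (Q \<eta> t)\<bar>) \<partial>lborel)
        = (\<integral>\<^sup>+ t. ennreal (\<bar>(t - \<mu>\<^sub>t) * (a * t + b * deriv (\<lambda>s. \<theta> s \<eta>) t - \<mu>\<^sub>u)\<bar> * (\<psi> t \<eta>)\<^sup>2) \<partial>lborel)"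
    using assms(5-10) AE_space
  proof eventually_elim
    case (elim \<eta>)
    from elim(4) obtain \<psi>' where \<psi>': "\<And>t. ((\<lambda>t. \<psi> t \<eta>) has_vector_derivative \<psi>' t) (at t)" "continuous_on UNIV \<psi>'"
      by (auto simp: C1_differentiable_on_def)
    from elim(5) obtain \<theta>' where \<theta>': "\<And>t. ((\<lambda>t. \<theta> t \<eta>) has_vector_derivative \<theta>' t) (at t)" "continuous_on UNIV \<theta>'"
      by (auto simp: C1_differentiable_on_def)
    define E where "E t = exp (\<i> * of_real (\<theta> t \<eta>))" for t
    have f_eq: "f t \<eta> = of_real (\<psi> t \<eta>) * E t" for t
      using assms(2)[OF elim(7)] by (simp add: E_def)
    define f' where "f' t = (of_real (\<psi>' t) + \<i> * of_real (\<psi> t \<eta> * \<theta>' t)) * E t" for t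
    have E': "(E has_vector_derivative (\<i> * of_real (\<theta>' t)) * E t) (at t)" for t
    proof -
      have "((\<lambda>x. iexp x) has_vector_derivative \<i> * iexp (\<theta> t \<eta>)) (at (\<theta> t \<eta>))"
        by (rule has_vector_derivative_real_field) (auto intro!: derivative_eq_intros)
      from vector_diff_chain_at[OF \<theta>'(1) this]
      show ?thesis
        by (simp add: E_def[abs_def] o_def scaleR_conv_of_real ac_simps)
    qed
    have f': "((\<lambda>t. f t \<eta>) has_vector_derivative f' t) (at t)" for t
    proof -
      have "((\<lambda>t. of_real (\<psi> t \<eta>) :: complex) has_vector_derivative of_real (\<psi>' t)) (at t)"
        by (rule has_vector_derivative_of_real) (use \<psi>'(1) in \<open>simp add: has_real_derivative_iff_has_vector_derivative\<close>)
      from has_vector_derivative_mult[OF this E'] show ?thesis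
        by (simp add: f_eq[abs_def] f'_def algebra_simps)
    qed
    have D_eq: "D \<eta> t = f' t" for t
      unfolding D_def by (rule limI) (rule forward_difference_quotient_tendsto[OF f'])
    have cont_\<psi>: "continuous_on UNIV (\<lambda>t. \<psi> t \<eta>)"
      using \<psi>'(1) by (meson continuous_at_imp_continuous_on has_vector_derivative_continuous)
    have cont_E: "continuous_on UNIV E"
      using E' by (meson continuous_at_imp_continuous_on has_vector_derivative_continuous)
    have cont_f': "continuous_on UNIV f'"
      unfolding f'_def by (intro continuous_intros cont_E cont_\<psi> \<psi>'(2) \<theta>'(2))
    have cont_f: "continuous_on UNIV (\<lambda>t. f t \<eta>)"
      using f' by (meson continuous_at_imp_continuous_on has_vector_derivative_continuous)
    obtain B where B: "\<And>t. cmod (f t \<eta>) \<le> B"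
      using bounded_of_continuous_tendsto_0[OF cont_f elim(6)] by blast
    have f'_sq: "square_integrable lborel f'"
      using elim(3) by (simp add: vector_derivative_at[OF f'])
    have "(\<integral>\<^sup>+ t. ennreal ((cmod (Q \<eta> t))\<^sup>2) \<partial>lborel)
        \<le> (\<integral>\<^sup>+ t. ennreal ((cmod (H \<eta> t))\<^sup>2) \<partial>lborel)"
      by (intro nn_integral_mono ennreal_leI power_mono)
        (auto simp: Q_def norm_mult norm_sgn)
    also have "\<dots> \<le> (\<integral>\<^sup>+ u. ennreal ((u - \<mu>\<^sub>u)\<^sup>2 * (cmod (signal_lct a b c d f u \<eta>))\<^sup>2) \<partial>lborel)"
      unfolding H_def signal_lct_def D_eq
    proof (rule lct_second_moment_ge[OF assms(11) f' _ _ B])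
      show "integrable lborel (\<lambda>t. f t \<eta>)"
        using elim by (intro integrable_of_square_integrable_moment)
      show "f' \<in> borel_measurable borel"
        using cont_f' by (rule borel_measurable_continuous_onI)
    qed
    moreover have "ennreal (\<bar>b\<bar> / 2) * (\<integral>\<^sup>+ t. ennreal ((cmod (f t \<eta>))\<^sup>2) \<partial>lborel)
        \<le> (\<integral>\<^sup>+ t. ennreal (\<bar>X \<eta> t\<bar> * \<bar>Re (Q \<eta> t)\<bar>) \<partial>lborel)"
    proof -
      have [measurable]: "(\<lambda>t. f t \<eta>) \<in> borel_measurable borel" "f' \<in> borel_measurable borel"
        using cont_f cont_f' by (auto intro: borel_measurable_continuous_onI)
      have "ennreal (\<bar>b\<bar> / 2) * (\<integral>\<^sup>+ t. ennreal ((cmod (f t \<eta>))\<^sup>2) \<partial>lborel)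
          = ennreal \<bar>b\<bar> * (ennreal (1 / 2) * (\<integral>\<^sup>+ t. ennreal ((cmod (f t \<eta>))\<^sup>2) \<partial>lborel))"
        by (subst mult.assoc[symmetric], subst ennreal_mult[symmetric]) simp_all
      also have "\<dots> \<le> ennreal \<bar>b\<bar> * (\<integral>\<^sup>+ t. ennreal (\<bar>t - \<mu>\<^sub>t\<bar> * \<bar>Re (cnj (f t \<eta>) * f' t)\<bar>) \<partial>lborel)"
        using elim f'_sq by (intro mult_left_mono half_energy_le_weighted_correlation f' cont_f') auto
      also have "\<dots> = (\<integral>\<^sup>+ t. ennreal (\<bar>X \<eta> t\<bar> * \<bar>Re (Q \<eta> t)\<bar>) \<partial>lborel)"
        unfolding correlation D_eq
        by (subst nn_integral_cmult[symmetric], measurable)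
           (simp only: ennreal_mult[symmetric] abs_ge_zero mult_nonneg_nonneg mult.left_commute mult.assoc)
      finally show ?thesis .
    qed
    moreover have "\<bar>X \<eta> t\<bar> * \<bar>Im (Q \<eta> t)\<bar>
        = \<bar>(t - \<mu>\<^sub>t) * (a * t + b * deriv (\<lambda>s. \<theta> s \<eta>) t - \<mu>\<^sub>u)\<bar> * (\<psi> t \<eta>)\<^sup>2" for t
    proof -
      have \<theta>'_eq: "deriv (\<lambda>s. \<theta> s \<eta>) t = \<theta>' t"
        using \<theta>'(1)[of t] by (intro DERIV_imp_deriv) (simp add: has_real_derivative_iff_has_vector_derivative)
      have norm_E: "cmod (E t) = 1"
        by (simp add: E_def)
      then have "cnj (E t) * E t = 1"
        by (metis complex_norm_square mult.commute of_real_1 power_one)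
      then have "cnj (f t \<eta>) * f' t = of_real (\<psi> t \<eta>) * (of_real (\<psi>' t) + \<i> * of_real (\<psi> t \<eta> * \<theta>' t))"
        by (simp add: f_eq f'_def mult.left_commute mult.commute)
      then have "Im (cnj (f t \<eta>) * f' t) = (\<psi> t \<eta>)\<^sup>2 * \<theta>' t"
        by (simp add: power2_eq_square)
      moreover have "(cmod (f t \<eta>))\<^sup>2 = (\<psi> t \<eta>)\<^sup>2"
        using norm_E by (simp add: f_eq norm_mult)
      ultimately have "b * Im (cnj (f t \<eta>) * D \<eta> t) + (a * t - \<mu>\<^sub>u) * (cmod (f t \<eta>))\<^sup>2
          = (a * t + b * \<theta>' t - \<mu>\<^sub>u) * (\<psi> t \<eta>)\<^sup>2"
        unfolding D_eq by (simp only:) (simp add: algebra_simps)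
      then show ?thesis
        by (simp only: correlation \<theta>'_eq abs_mult abs_power2 mult.assoc)
    qed
    ultimately show ?case
      by simp
  qed

  have unit_energy: "(\<integral>\<^sup>+ \<eta>. \<integral>\<^sup>+ t. ennreal ((cmod (f t \<eta>))\<^sup>2) \<partial>lborel \<partial>P) = 1"
  proof -
    \<comment> \<open>A Bochner integral with the nonzero value \<open>1\<close> must converge, so the norm condition carries over
      to the integral in \<open>[0, \<infinity>]\<close>.\<close>
    have 1: "(LINT \<eta>|P. LINT t|lborel. (cmod (f t \<eta>))\<^sup>2) = 1"
      using assms(4) by (simp add: signal_norm_def real_sqrt_eq_1_iff)
    then have int: "integrable P (\<lambda>\<eta>. LINT t|lborel. (cmod (f t \<eta>))\<^sup>2)"
      using not_integrable_integral_eq by fastforce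
    have "(\<integral>\<^sup>+ \<eta>. \<integral>\<^sup>+ t. ennreal ((cmod (f t \<eta>))\<^sup>2) \<partial>lborel \<partial>P)
        = (\<integral>\<^sup>+ \<eta>. ennreal (LINT t|lborel. (cmod (f t \<eta>))\<^sup>2) \<partial>P)"
    proof (rule nn_integral_cong_AE)
      show "AE \<eta> in P. (\<integral>\<^sup>+ t. ennreal ((cmod (f t \<eta>))\<^sup>2) \<partial>lborel)
          = ennreal (LINT t|lborel. (cmod (f t \<eta>))\<^sup>2)"
        using assms(5) by eventually_elim (simp add: square_integrable_def nn_integral_eq_integral)
    qed
    also have "\<dots> = ennreal 1"
      using nn_integral_eq_integral[OF int] 1 by simp
    finally show ?thesis by simp
  qed

  have "ennreal (\<bar>b\<bar> / 2) \<le> (\<integral>\<^sup>+ \<eta>. \<integral>\<^sup>+ t. ennreal (\<bar>X \<eta> t\<bar> * \<bar>Re (Q \<eta> t)\<bar>) \<partial>lborel \<partial>P)"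
  proof -
    have "ennreal (\<bar>b\<bar> / 2) = (\<integral>\<^sup>+ \<eta>. ennreal (\<bar>b\<bar> / 2) * (\<integral>\<^sup>+ t. ennreal ((cmod (f t \<eta>))\<^sup>2) \<partial>lborel) \<partial>P)"
    proof (subst nn_integral_cmult)
      show "(\<lambda>\<eta>. \<integral>\<^sup>+ t. ennreal ((cmod (f t \<eta>))\<^sup>2) \<partial>lborel) \<in> borel_measurable P"
        using lborel.borel_measurable_nn_integral_fst[of "\<lambda>z. ennreal ((cmod (f (snd z) (fst z)))\<^sup>2)" P] by simp
    qed (simp add: unit_energy)
    also have "\<dots> \<le> (\<integral>\<^sup>+ \<eta>. \<integral>\<^sup>+ t. ennreal (\<bar>X \<eta> t\<bar> * \<bar>Re (Q \<eta> t)\<bar>) \<partial>lborel \<partial>P)"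
      using sample by (intro nn_integral_mono_AE) (auto elim: eventually_mono)
    finally show ?thesis .
  qed
  from power_mono[OF this, of 2]
  have "ennreal (b\<^sup>2 / 4) \<le> (\<integral>\<^sup>+ \<eta>. \<integral>\<^sup>+ t. ennreal (\<bar>X \<eta> t\<bar> * \<bar>Re (Q \<eta> t)\<bar>) \<partial>lborel \<partial>P)\<^sup>2"
    by (simp add: ennreal_power power_divide)
  moreover have "(\<integral>\<^sup>+ \<eta>. \<integral>\<^sup>+ t. ennreal (\<bar>(t - \<mu>\<^sub>t) * (a * t + b * deriv (\<lambda>s. \<theta> s \<eta>) t - \<mu>\<^sub>u)\<bar> * (\<psi> t \<eta>)\<^sup>2) \<partial>lborel \<partial>P)
      = (\<integral>\<^sup>+ \<eta>. \<integral>\<^sup>+ t. ennreal (\<bar>X \<eta> t\<bar> * \<bar>Im (Q \<eta> t)\<bar>) \<partial>lborel \<partial>P)"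
    using sample by (intro nn_integral_cong_AE) (auto elim: eventually_mono)
  ultimately have "ennreal (b\<^sup>2 / 4)
      + (\<integral>\<^sup>+ \<eta>. \<integral>\<^sup>+ t. ennreal (\<bar>(t - \<mu>\<^sub>t) * (a * t + b * deriv (\<lambda>s. \<theta> s \<eta>) t - \<mu>\<^sub>u)\<bar> * (\<psi> t \<eta>)\<^sup>2) \<partial>lborel \<partial>P)\<^sup>2
      \<le> (\<integral>\<^sup>+ \<eta>. \<integral>\<^sup>+ t. ennreal (\<bar>X \<eta> t\<bar> * \<bar>Re (Q \<eta> t)\<bar>) \<partial>lborel \<partial>P)\<^sup>2
      + (\<integral>\<^sup>+ \<eta>. \<integral>\<^sup>+ t. ennreal (\<bar>X \<eta> t\<bar> * \<bar>Im (Q \<eta> t)\<bar>) \<partial>lborel \<partial>P)\<^sup>2"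
    by (simp add: add_right_mono)
  also have "\<dots> \<le> (\<integral>\<^sup>+ \<eta>. \<integral>\<^sup>+ t. ennreal ((X \<eta> t)\<^sup>2) \<partial>lborel \<partial>P)
      * (\<integral>\<^sup>+ \<eta>. \<integral>\<^sup>+ t. ennreal ((cmod (Q \<eta> t))\<^sup>2) \<partial>lborel \<partial>P)"
    using Cauchy_Schwarz_Re_Im[OF X_meas Q_meas] by (simp add: iterated)
  also have "(\<integral>\<^sup>+ \<eta>. \<integral>\<^sup>+ t. ennreal ((X \<eta> t)\<^sup>2) \<partial>lborel \<partial>P) = expected_variance P f"
    by (simp add: expected_variance_def X_def power_mult_distrib assms(13))
  also have "(\<integral>\<^sup>+ \<eta>. \<integral>\<^sup>+ t. ennreal ((cmod (Q \<eta> t))\<^sup>2) \<partial>lborel \<partial>P)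
      \<le> expected_variance P (signal_lct a b c d f)"
    unfolding expected_variance_def assms(15)[symmetric]
    using sample by (intro nn_integral_mono_AE) (auto elim: eventually_mono)
  finally show ?thesis
    by (simp add: mult_left_mono)
qed

end
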